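(* Let $\mathfrak{a}$ and $\mathfrak{b}$ be confocal ellipses. Take $A\in\mathfrak{a}$, $O\in\mathfrak{b}$. Denote by $I$ the point where the tangent line to $\mathfrak{a}$ at $A$ intersects the tangent line to $\mathfrak{b}$ at $O$ ($I$ may lie on the line at infinity). If $B\neq A$ is the point where the second tangent line from $I$ to $\mathfrak{a}$ touches the ellipse $\mathfrak{a}$, then $OB=\mathcal{B}(OA)$, where $\mathcal{B}$ is the billiard map in $\mathfrak{b}$.
   Context: Ellipses in the Euclidean plane are confocal if they have the same foci. The Euclidean plane is viewed as an affine chart of the real projective plane, so two lines may meet on the line at infinity. A billiard system describes a free point moving with constant speed along a straight line inside a plane domain until it hits the boundary, where it reflects by the law "the angle of incidence equals the angle of reflection". The billiard map acts on oriented lines that intersect the billiard table, sending the incoming billiard trajectory to the outgoing one; $\mathcal{B}$ denotes the billiard map in the ellipse $\mathfrak{b}$. A pair of points, such as $OA$ or $OB$, is used to denote both the line through them and the oriented line; in the latter case the order of the letters matters. *)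

theory Defs
  imports "HOL-Analysis.Analysis"
begin

type_synonym plane = "real^2"

definition focal_sum :: "plane \<Rightarrow> plane \<Rightarrow> plane \<Rightarrow> real" where
  "focal_sum F G X = dist X F + dist X G"

(* A genuine ellipse iff dist F G < s (a circle if F = G).  Ellipses are confocal iff
   they have the form ellipse F G s, ellipse F G r with the same F and G. *)
definition ellipse :: "plane \<Rightarrow> plane \<Rightarrow> real \<Rightarrow> plane set" where
  "ellipse F G s = {X. focal_sum F G X = s}"

(* The gradient of the focal sum, i.e. an outward normal at P to the ellipse with foci F, G
   that passes through P.  It exists at every point of a genuine ellipse, see normal_eq. *)
definition normal :: "plane \<Rightarrow> plane \<Rightarrow> plane \<Rightarrow> plane" where
  "normal F G P = (THE n. GDERIV (focal_sum F G) P :> n)"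

lemma normal_eq:
  assumes "P \<noteq> F" "P \<noteq> G"
  shows "GDERIV (focal_sum F G) P :> sgn (P - F) + sgn (P - G)"
    and "normal F G P = sgn (P - F) + sgn (P - G)"
proof -
  have D: "((\<lambda>X. dist X H) has_derivative (\<lambda>h. h \<bullet> sgn (P - H))) (at P)"
    if "P \<noteq> H" for H
  proof -
    have 1: "((\<lambda>X. X - H) has_derivative (\<lambda>h. h)) (at P)"
      by (auto intro!: derivative_eq_intros)
    have 2: "(norm has_derivative (\<lambda>h. h \<bullet> sgn (P - H))) (at (P - H))"
      using that by (intro has_derivative_norm) auto
    show ?thesis
      unfolding dist_norm by (rule has_derivative_compose[OF 1 2])
  qed
  show gd: "GDERIV (focal_sum F G) P :> sgn (P - F) + sgn (P - G)"
    using has_derivative_add[OF D[OF assms(1)] D[OF assms(2)]]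
    unfolding gderiv_def focal_sum_def[abs_def] by (simp add: inner_add_right)
  show "normal F G P = sgn (P - F) + sgn (P - G)"
    unfolding normal_def
  proof (rule the_equality[where P = "\<lambda>n. GDERIV (focal_sum F G) P :> n", OF gd])
    fix n assume "GDERIV (focal_sum F G) P :> n"
    then have "(\<lambda>h. h \<bullet> n) = (\<lambda>h. h \<bullet> (sgn (P - F) + sgn (P - G)))"
      using gd unfolding gderiv_def by (rule has_derivative_unique)
    then have "\<And>h. h \<bullet> n = h \<bullet> (sgn (P - F) + sgn (P - G))"
      by (rule fun_cong)
    then show "n = sgn (P - F) + sgn (P - G)"
      using vector_eq_ldot by blast
  qed
qed

definition tangent_line :: "plane \<Rightarrow> plane \<Rightarrow> plane \<Rightarrow> plane set" where
  "tangent_line F G P = {X. normal F G P \<bullet> (X - P) = 0}"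

(* Points of the real projective plane containing the affine chart "plane"; a point at infinity
   is given by the direction space (a line through the origin) of the lines passing through it. *)
datatype proj_point = Finite plane | Ideal "plane set"

definition proj_closure :: "plane set \<Rightarrow> proj_point set" where
  "proj_closure L = insert (Ideal {Y - X | X Y. X \<in> L \<and> Y \<in> L}) (Finite ` L)"

(* An oriented line is represented by its point set and its unit direction vector. *)
type_synonym oriented_line = "plane set \<times> plane"

definition oline :: "plane \<Rightarrow> plane \<Rightarrow> oriented_line" where
  "oline X Y = (affine hull {X, Y}, sgn (Y - X))"

definition table :: "plane \<Rightarrow> plane \<Rightarrow> real \<Rightarrow> plane set" where
  "table F G r = {X. focal_sum F G X < r}"

(* The line l intersects the table, and X is the last point of the boundary ellipse on l,
   i.e. the point where motion along l inside the table hits the boundary. *)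
definition hits :: "plane \<Rightarrow> plane \<Rightarrow> real \<Rightarrow> oriented_line \<Rightarrow> plane \<Rightarrow> bool" where
  "hits F G r l X \<longleftrightarrow>
     fst l \<inter> table F G r \<noteq> {} \<and> X \<in> fst l \<inter> ellipse F G r \<and>
     (\<forall>Y \<in> fst l \<inter> ellipse F G r. Y \<bullet> snd l \<le> X \<bullet> snd l)"

definition mirror :: "plane \<Rightarrow> plane \<Rightarrow> plane" where
  "mirror n v = v - (2 * (v \<bullet> n) / (n \<bullet> n)) *\<^sub>R n"

(* Meaningful on the oriented lines that intersect the table: the outgoing line starts at the
   hitting point X, in the incoming direction reflected in the tangent line at X. *)
definition billiard_map :: "plane \<Rightarrow> plane \<Rightarrow> real \<Rightarrow> oriented_line \<Rightarrow> oriented_line" where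
  "billiard_map F G r l =
     (let X = (THE X. hits F G r l X) in oline X (X + mirror (normal F G X) (snd l)))"

end

theory Submission
  imports Defs
begin

text \<open>Let \<open>Q\<^sub>k\<close> be the linear map whose quadratic form equals \<open>1\<close> on the ellipse with squared semiaxis
  \<open>k\<close>. The inverses of \<open>Q\<^sub>k\<close> and \<open>Q\<^sub>l\<close> differ by the scalar \<open>k - l\<close>, so the pole \<open>Z\<close> with respect to
  \<open>\<aa>\<close> of the tangent to \<open>\<bb>\<close> at \<open>P\<close> lies on the normal of \<open>\<bb>\<close> at \<open>P\<close>. As \<open>I\<close> lies on that tangent,
  \<open>Z\<close> also lies on the polar \<open>AB\<close> of \<open>I\<close>. Hence the normal \<open>n\<close> is a combination of \<open>A - P\<close> and \<open>B - P\<close>,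
  and evaluating the polar form of \<open>\<aa>\<close> at \<open>(Z, A)\<close> and \<open>(Z, B)\<close> shows that the coefficients are
  proportional to \<open>n \<bullet> (B - P)\<close> and \<open>n \<bullet> (A - P)\<close>, which is the reflection law.\<close>

section \<open>Quadratic forms of confocal conics\<close>

text \<open>With \<open>d\<close> half the vector between the foci, this scales the direction of
  \<open>d\<close> by \<open>1/k\<close> and its orthogonal complement by
  \<open>1/(k - d \<bullet> d)\<close>: it is the matrix of the centred conic. This coordinate-free
  form also covers the circle \<open>d = 0\<close>.\<close>

definition conic_map :: "'a::real_inner \<Rightarrow> real \<Rightarrow> 'a \<Rightarrow> 'a" where
  "conic_map d k x = (1 / (k * (k - d \<bullet> d))) *\<^sub>R (k *\<^sub>R x - (x \<bullet> d) *\<^sub>R d)"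

lemma conic_map_inner:
  "conic_map d k x \<bullet> y = (k * (x \<bullet> y) - (x \<bullet> d) * (y \<bullet> d)) / (k * (k - d \<bullet> d))"
  by (simp add: conic_map_def inner_diff_left inner_commute[of d y])

lemma conic_map_inner_commute: "conic_map d k x \<bullet> y = conic_map d k y \<bullet> x"
  by (simp add: conic_map_inner inner_commute[of x y] mult.commute[of "x \<bullet> d"])

lemma conic_map_pos:
  assumes "d \<bullet> d < k" and "x \<noteq> 0"
  shows "conic_map d k x \<bullet> x > 0"
proof -
  have k: "0 < k" using assms(1) inner_ge_zero[of d] by linarith
  have "(x \<bullet> d) * (x \<bullet> d) \<le> (x \<bullet> x) * (d \<bullet> d)"
    using Cauchy_Schwarz_ineq[of x d] by (simp add: power2_eq_square)
  also have "\<dots> < (x \<bullet> x) * k"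
    using assms by (intro mult_strict_left_mono) auto
  finally show ?thesis
    using assms(1) k by (simp add: conic_map_inner mult.commute)
qed

text \<open>The inverse of the map for \<open>k\<close> multiplies by \<open>k\<close> along
  \<open>d\<close> and by \<open>k - d \<bullet> d\<close> across it, so the inverses for
  \<open>k\<close> and \<open>l\<close> differ by \<open>k - l\<close> times the identity. The
  argument on the left is thus the pole, for the conic \<open>k\<close>, of the tangent at
  \<open>p\<close> to the conic \<open>l\<close>. The proof compares coefficients of
  \<open>p\<close> and \<open>d\<close>.\<close>

lemma conic_map_confocal_pole:
  assumes "k \<noteq> 0" "k \<noteq> d \<bullet> d" "l \<noteq> 0" "l \<noteq> d \<bullet> d"
  shows "conic_map d k (p + (k - l) *\<^sub>R conic_map d l p) = conic_map d l p"
proof -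
  define c where "c = 1 / (l * (l - d \<bullet> d))"
  define e where "e = 1 / (k * (k - d \<bullet> d))"
  define u where "u = p \<bullet> d"
  have n: "conic_map d l p = (c * l) *\<^sub>R p - (c * u) *\<^sub>R d"
    by (simp add: conic_map_def c_def u_def scaleR_diff_right)
  have c: "c * l * (l - d \<bullet> d) = 1" and e: "e * k * (k - d \<bullet> d) = 1"
    using assms by (simp_all add: c_def e_def)
  have z: "p + (k - l) *\<^sub>R conic_map d l p
      = (1 + (k - l) * c * l) *\<^sub>R p - ((k - l) * c * u) *\<^sub>R d"
    unfolding n by (simp add: algebra_simps)
  have 1: "e * k * (1 + (k - l) * c * l) = c * l"
    using c e by algebra
  have 2: "e * (k * ((k - l) * c * u)
      + (1 + (k - l) * c * l) * u - (k - l) * c * u * (d \<bullet> d)) = c * u"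
    using c e by algebra
  have "conic_map d k (p + (k - l) *\<^sub>R conic_map d l p)
    = (e * k * (1 + (k - l) * c * l)) *\<^sub>R p
      - (e * (k * ((k - l) * c * u)
      + (1 + (k - l) * c * l) * u - (k - l) * c * u * (d \<bullet> d))) *\<^sub>R d"
    unfolding z conic_map_def[of d k] e_def[symmetric]
    by (simp add: inner_diff_left inner_add_left u_def[symmetric] algebra_simps)
  then show ?thesis unfolding 1 2 n .
qed

text \<open>The pole on the left of the last hypothesis lies on the chord through \<open>x\<close>
  and \<open>y\<close> with parameter \<open>t\<close>. Its polar form against \<open>x\<close> and
  \<open>y\<close> gives the two inner products with \<open>n\<close> in terms of \<open>t\<close>,
  so that \<open>t\<close> can be eliminated. The sign of \<open>m\<close> is kept to orient the
  reflected ray later.\<close>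

lemma confocal_normal_decomposition:
  fixes d x y p :: "'a::real_inner"
  assumes k: "d \<bullet> d < k" and l: "d \<bullet> d < l"
    and x: "conic_map d k x \<bullet> x = 1" and y: "conic_map d k y \<bullet> y = 1" and "x \<noteq> y"
    and p: "conic_map d l p \<bullet> p = 1"
    and n: "n = conic_map d l p"
    and z: "p + (k - l) *\<^sub>R n = x + t *\<^sub>R (y - x)"
  obtains m where "m < 0"
    "((k - l) * m) *\<^sub>R n = (n \<bullet> (y - p)) *\<^sub>R (x - p) + (n \<bullet> (x - p)) *\<^sub>R (y - p)"
proof -
  define m where "m = conic_map d k x \<bullet> y - 1"
  have lin: "conic_map d k (u - v) \<bullet> w = conic_map d k u \<bullet> w - conic_map d k v \<bullet> w"
    and lin': "conic_map d k (u + c *\<^sub>R v) \<bullet> w = conic_map d k u \<bullet> w + c * (conic_map d k v \<bullet> w)"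
    for u v w c
    by (simp_all add: conic_map_inner inner_diff_left inner_add_left algebra_simps
        add_divide_distrib diff_divide_distrib)
  have sym: "conic_map d k y \<bullet> x = conic_map d k x \<bullet> y"
    by (rule conic_map_inner_commute)
  \<comment> \<open>Expanding the positive form at \<open>x - y\<close>, where both points have
    value 1, yields \<open>2 - 2 * (m + 1)\<close>.\<close>
  have "0 < conic_map d k (x - y) \<bullet> (x - y)"
    using k \<open>x \<noteq> y\<close> by (intro conic_map_pos) auto
  also have "\<dots> = - 2 * m"
    by (simp add: lin inner_diff_right x y sym m_def)
  finally have m: "m < 0" by simp
  have "0 < k" "0 < l" using k l inner_ge_zero[of d] by linarith+
  then have nz: "n = conic_map d k (x + t *\<^sub>R (y - x))"
    using conic_map_confocal_pole[of k d l p] k l unfolding z[symmetric] n by simp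
  have n_inner: "n \<bullet> w = conic_map d k x \<bullet> w + t * (conic_map d k y \<bullet> w - conic_map d k x \<bullet> w)" for w
    unfolding nz lin' lin ..
  have nx: "n \<bullet> (x - p) = t * m" and ny: "n \<bullet> (y - p) = (1 - t) * m"
    using p unfolding n[symmetric] inner_diff_right
    by (simp_all add: n_inner[of x] n_inner[of y] x y sym m_def algebra_simps)
  have "(k - l) *\<^sub>R n = (1 - t) *\<^sub>R (x - p) + t *\<^sub>R (y - p)"
  proof -
    have "(k - l) *\<^sub>R n = x + t *\<^sub>R (y - x) - p" using z by (simp add: algebra_simps)
    then show ?thesis by (simp add: algebra_simps)
  qed
  \<comment> \<open>Multiplying by \<open>m\<close> turns the weights \<open>1 - t\<close> and
    \<open>t\<close> into the inner products \<open>ny\<close> and \<open>nx\<close>.\<close>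
  then have "m *\<^sub>R ((k - l) *\<^sub>R n) = m *\<^sub>R ((1 - t) *\<^sub>R (x - p) + t *\<^sub>R (y - p))" by simp
  then have "((k - l) * m) *\<^sub>R n = (n \<bullet> (y - p)) *\<^sub>R (x - p) + (n \<bullet> (x - p)) *\<^sub>R (y - p)"
    unfolding nx ny by (simp add: scaleR_add_right mult.commute)
  with m show ?thesis by (rule that)
qed

section \<open>Reflection in a line\<close>

lemma mirror_scaleR: "mirror n (c *\<^sub>R v) = c *\<^sub>R mirror n v"
  by (simp add: mirror_def scaleR_diff_right)

lemma mirror_normal_scaleR: "c \<noteq> 0 \<Longrightarrow> mirror (c *\<^sub>R n) v = mirror n v"
  by (simp add: mirror_def)

lemma norm_mirror:
  assumes "n \<noteq> 0"
  shows "norm (mirror n v) = norm v"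
proof -
  have "n \<bullet> n \<noteq> 0" using assms by simp
  then have "mirror n v \<bullet> mirror n v = v \<bullet> v"
    by (simp add: mirror_def inner_diff_left inner_diff_right inner_commute field_simps power2_eq_square)
  then show ?thesis by (simp add: norm_eq_sqrt_inner)
qed

lemma mirror_sgn: "n \<noteq> 0 \<Longrightarrow> mirror n (sgn v) = sgn (mirror n v)"
  by (simp add: sgn_div_norm mirror_scaleR norm_mirror)

lemma mirror_uminus: "mirror n (- v) = - mirror n v"
  by (simp add: mirror_def)

text \<open>Pairing the hypothesis with \<open>n\<close> gives
  \<open>c * (n \<bullet> n) = 2 * (n \<bullet> v) * (n \<bullet> w)\<close>. This fixes the sign of
  the product and reduces the factor in \<open>mirror\<close> to \<open>c / (n \<bullet> w)\<close>,
  so the component of \<open>v\<close> cancels.\<close>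

lemma mirror_of_combination:
  fixes n v w :: plane
  assumes "c *\<^sub>R n = (n \<bullet> w) *\<^sub>R v + (n \<bullet> v) *\<^sub>R w" "c \<noteq> 0" "n \<noteq> 0"
  shows "(n \<bullet> v) * (n \<bullet> w) * c > 0"
    and "mirror n v = - ((n \<bullet> v) / (n \<bullet> w)) *\<^sub>R w"
proof -
  have "n \<bullet> (c *\<^sub>R n) = n \<bullet> ((n \<bullet> w) *\<^sub>R v + (n \<bullet> v) *\<^sub>R w)"
    using assms(1) by simp
  then have eq: "c * (n \<bullet> n) = 2 * (n \<bullet> v) * (n \<bullet> w)"
    by (simp add: inner_add_right)
  then have "2 * ((n \<bullet> v) * (n \<bullet> w) * c) = c\<^sup>2 * (n \<bullet> n)"
    by (simp add: power2_eq_square)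
  then have "0 < 2 * ((n \<bullet> v) * (n \<bullet> w) * c)"
    using assms by simp
  then show "(n \<bullet> v) * (n \<bullet> w) * c > 0" by linarith
  then have nz: "n \<bullet> v \<noteq> 0" "n \<bullet> w \<noteq> 0" by auto
  have n: "n = ((n \<bullet> w) / c) *\<^sub>R v + ((n \<bullet> v) / c) *\<^sub>R w"
  proof -
    have "n = (1 / c) *\<^sub>R (c *\<^sub>R n)" using assms(2) by simp
    then show ?thesis unfolding assms(1) by (simp add: scaleR_add_right)
  qed
  have f: "2 * (v \<bullet> n) / (n \<bullet> n) = c / (n \<bullet> w)"
    using eq nz assms(3) by (simp add: inner_commute field_simps)
  have "(c / (n \<bullet> w)) *\<^sub>R n = (1 / (n \<bullet> w)) *\<^sub>R ((n \<bullet> w) *\<^sub>R v + (n \<bullet> v) *\<^sub>R w)"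
    by (simp flip: assms(1))
  also have "\<dots> = v + ((n \<bullet> v) / (n \<bullet> w)) *\<^sub>R w"
    using nz by (simp add: scaleR_add_right)
  finally show "mirror n v = - ((n \<bullet> v) / (n \<bullet> w)) *\<^sub>R w"
    by (simp add: mirror_def f)
qed

section \<open>From the focal sum to the quadratic equation\<close>

text \<open>The classical focal radii \<open>a - e x\<close> and \<open>a + e x\<close>: the sum of
  the two distances is known, and the difference of their squares is linear in \<open>x\<close>,
  which determines their difference.\<close>

lemma ellipse_focal_distance:
  fixes F G X :: plane
  assumes "dist F G < s" "X \<in> ellipse F G s"
  defines "d \<equiv> (1/2) *\<^sub>R (F - G)" and "x \<equiv> X - midpoint F G"
  shows "norm (X - F) = s/2 - (x \<bullet> d) / (s/2)"
    and "norm (X - G) = s/2 + (x \<bullet> d) / (s/2)"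
proof -
  have s: "0 < s" using assms(1) zero_le_dist[of F G] by linarith
  define u v where "u = norm (X - F)" and "v = norm (X - G)"
  have F: "X - F = x - d" and G: "X - G = x + d"
    by (simp_all add: x_def d_def midpoint_def algebra_simps flip: scaleR_add_left scaleR_diff_left)
  have 1: "u + v = s" using assms(2) by (simp add: ellipse_def focal_sum_def dist_norm u_def v_def)
  have "u\<^sup>2 - v\<^sup>2 = - 4 * (x \<bullet> d)"
    unfolding u_def v_def F G power2_norm_eq_inner
    by (simp add: inner_diff_left inner_diff_right inner_add_left inner_add_right inner_commute)
  then have "(u - v) * s = - 4 * (x \<bullet> d)"
    unfolding 1[symmetric] by (simp add: power2_eq_square algebra_simps)
  then have 2: "u - v = - 4 * (x \<bullet> d) / s" using s by (simp add: field_simps)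
  show "norm (X - F) = s/2 - (x \<bullet> d) / (s/2)" "norm (X - G) = s/2 + (x \<bullet> d) / (s/2)"
    using 1 2 by (simp_all add: u_def[symmetric] v_def[symmetric] field_simps)
qed

text \<open>Squaring a focal radius gives the quadratic equation; inserting both radii into the sum
  of unit vectors gives the normal. The factor \<open>c\<close> is positive, so the image of
  \<open>x\<close> is again an outward normal.\<close>

lemma ellipse_conic:
  fixes F G X :: plane
  assumes "dist F G < s" "X \<in> ellipse F G s"
  defines "d \<equiv> (1/2) *\<^sub>R (F - G)" and "x \<equiv> X - midpoint F G"
  shows "d \<bullet> d < (s/2)\<^sup>2"
    and "conic_map d ((s/2)\<^sup>2) x \<bullet> x = 1"
    and "\<exists>c>0. normal F G X = c *\<^sub>R conic_map d ((s/2)\<^sup>2) x"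
proof -
  have s: "0 < s" using assms(1) zero_le_dist[of F G] by linarith
  define a where "a = s / 2"
  have a: "0 < a" using s by (simp add: a_def)
  have "norm d < a" using assms(1) by (simp add: d_def a_def dist_norm)
  then have "(norm d)\<^sup>2 < a\<^sup>2" by (intro power_strict_mono) auto
  then show da: "d \<bullet> d < (s/2)\<^sup>2" by (simp add: power2_norm_eq_inner a_def)
  define h where "h = (x \<bullet> d) / a"
  have ha: "x \<bullet> d = h * a" using a by (simp add: h_def)
  have F: "X - F = x - d" and G: "X - G = x + d"
    by (simp_all add: x_def d_def midpoint_def algebra_simps flip: scaleR_add_left scaleR_diff_left)
  note fd = ellipse_focal_distance[OF assms(1,2), folded d_def x_def a_def, folded h_def]
  have "(norm (X - F))\<^sup>2 = x \<bullet> x - 2 * (x \<bullet> d) + d \<bullet> d"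
    unfolding F power2_norm_eq_inner
    by (simp add: inner_diff_left inner_diff_right inner_commute)
  then have "(a - h)\<^sup>2 = x \<bullet> x - 2 * (h * a) + d \<bullet> d" unfolding fd(1) ha .
  then have "a\<^sup>2 + h\<^sup>2 = x \<bullet> x + d \<bullet> d" by (simp add: power2_eq_square algebra_simps)
  then have *: "a\<^sup>2 * (x \<bullet> x) - (x \<bullet> d) * (x \<bullet> d) = a\<^sup>2 * (a\<^sup>2 - d \<bullet> d)"
    unfolding ha by algebra
  have pos: "0 < a\<^sup>2 * (a\<^sup>2 - d \<bullet> d)" using a da by (simp add: a_def)
  show "conic_map d ((s/2)\<^sup>2) x \<bullet> x = 1"
    unfolding conic_map_inner a_def[symmetric] * using pos by (metis divide_self less_irrefl)
  have XF: "X \<noteq> F" and XG: "X \<noteq> G"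
    using assms(1,2) by (auto simp: ellipse_def focal_sum_def dist_commute)
  then have n1: "0 < a - h" and n2: "0 < a + h"
    using fd by (metis zero_less_norm_iff right_minus_eq)+
  \<comment> \<open>The common denominator of the reciprocal focal radii, scaled so that their sum
    is \<open>c * a\<^sup>2\<close> and their difference \<open>c * (x \<bullet> d)\<close>.\<close>
  define c where "c = 2 / (a * (a - h) * (a + h))"
  have c: "0 < c" using n1 n2 a by (simp add: c_def)
  have "normal F G X = (1 / (a - h)) *\<^sub>R (x - d) + (1 / (a + h)) *\<^sub>R (x + d)"
    unfolding normal_eq(2)[OF XF XG] sgn_div_norm fd unfolding F G by (simp add: inverse_eq_divide)
  also have "\<dots> = (1 / (a - h) + 1 / (a + h)) *\<^sub>R x - (1 / (a - h) - 1 / (a + h)) *\<^sub>R d"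
    by (simp add: algebra_simps)
  also have "1 / (a - h) + 1 / (a + h) = c * a\<^sup>2"
  proof -
    have "c * a\<^sup>2 = 2 * a / ((a - h) * (a + h))" using a by (simp add: c_def power2_eq_square)
    then show ?thesis using n1 n2 by (simp add: add_frac_eq)
  qed
  also have "1 / (a - h) - 1 / (a + h) = c * (x \<bullet> d)"
  proof -
    have "c * (x \<bullet> d) = 2 * h / ((a - h) * (a + h))" using a by (simp add: c_def ha)
    then show ?thesis using n1 n2 by (simp add: diff_frac_eq)
  qed
  also have "(c * a\<^sup>2) *\<^sub>R x - (c * (x \<bullet> d)) *\<^sub>R d
      = (c * (a\<^sup>2 * (a\<^sup>2 - d \<bullet> d))) *\<^sub>R conic_map d (a\<^sup>2) x"
    using a da[folded a_def] by (simp add: conic_map_def scaleR_diff_right)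
  finally show "\<exists>c>0. normal F G X = c *\<^sub>R conic_map d ((s/2)\<^sup>2) x"
    unfolding a_def[symmetric] using c pos by (metis mult_pos_pos)
qed

section \<open>Lines in the plane and their points at infinity\<close>

lemma exists_orthogonal_plane:
  fixes n :: plane
  shows "\<exists>t. t \<noteq> 0 \<and> n \<bullet> t = 0"
  using orthogonal_to_vector_exists[of n] unfolding orthogonal_def by auto

text \<open>In dimension two the vectors orthogonal to \<open>w\<close> form a line, so the
  determinant of \<open>u\<close> and \<open>v\<close> vanishes. This turns a common conormal into
  collinearity.\<close>

lemma orthogonal_complement_plane:
  fixes w u v :: plane
  assumes "w \<noteq> 0" "w \<bullet> u = 0" "w \<bullet> v = 0" "u \<noteq> 0"
  shows "\<exists>t. v = t *\<^sub>R u"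
proof -
  have w: "w$1 * u$1 + w$2 * u$2 = 0" "w$1 * v$1 + w$2 * v$2 = 0"
    and w0: "w$1 \<noteq> 0 \<or> w$2 \<noteq> 0" and u0: "u$1 \<noteq> 0 \<or> u$2 \<noteq> 0"
    using assms by (auto simp: inner_vec_def sum_2 vec_eq_iff forall_2)
  have det: "u$1 * v$2 = u$2 * v$1"
  proof -
    have "w$1 * (u$1 * v$2 - u$2 * v$1) = 0" "w$2 * (u$1 * v$2 - u$2 * v$1) = 0"
      using w by algebra+
    then show ?thesis using w0 by auto
  qed
  show ?thesis
  proof (cases "u$1 = 0")
    case False
    then show ?thesis using det
      by (intro exI[of _ "v$1 / u$1"]) (simp add: vec_eq_iff forall_2 field_simps)
  next
    case True
    then show ?thesis using det u0
      by (intro exI[of _ "v$2 / u$2"]) (simp add: vec_eq_iff forall_2 field_simps)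
  qed
qed

lemma directions_hyperplane:
  "{Y - X |X Y. X \<in> {X. n \<bullet> (X - P) = 0} \<and> Y \<in> {X. n \<bullet> (X - P) = 0}} = {v. n \<bullet> v = 0}"
proof (intro equalityI subsetI)
  fix v assume "v \<in> {v. n \<bullet> v = 0}"
  then show "v \<in> {Y - X |X Y. X \<in> {X. n \<bullet> (X - P) = 0} \<and> Y \<in> {X. n \<bullet> (X - P) = 0}}"
    by (intro CollectI exI[of _ P] exI[of _ "P + v"]) auto
qed (auto simp: inner_diff_right)

lemma proj_closure_tangent_line:
  "J \<in> proj_closure (tangent_line F G P) \<longleftrightarrow>
    (case J of Finite I \<Rightarrow> normal F G P \<bullet> (I - P) = 0 | Ideal S \<Rightarrow> S = {v. normal F G P \<bullet> v = 0})"
  unfolding proj_closure_def tangent_line_def directions_hyperplane by (cases J) auto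

section \<open>Convexity of the focal sum and hitting points\<close>

text \<open>Each distance to a focus lies above its linearization, by Cauchy-Schwarz; the tangent is
  therefore a supporting line.\<close>

lemma focal_sum_supporting:
  assumes "P \<noteq> F" "P \<noteq> G"
  shows "focal_sum F G P + normal F G P \<bullet> (X - P) \<le> focal_sum F G X"
proof -
  have "dist P H + sgn (P - H) \<bullet> (X - P) \<le> dist X H" if "P \<noteq> H" for H
  proof -
    have "dist P H + sgn (P - H) \<bullet> (X - P) = sgn (P - H) \<bullet> (X - H)"
    proof -
      have "sgn (P - H) \<bullet> (P - H) = dist P H"
        using that by (simp add: sgn_div_norm dist_norm dot_square_norm power2_eq_square)
      then show ?thesis by (simp add: inner_diff_right)
    qed
    also have "\<dots> \<le> norm (sgn (P - H)) * norm (X - H)" by (rule norm_cauchy_schwarz)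
    also have "\<dots> = dist X H" using that by (simp add: norm_sgn dist_norm)
    finally show ?thesis .
  qed
  from this[OF assms(1)] this[OF assms(2)] show ?thesis
    by (simp add: focal_sum_def normal_eq(2)[OF assms] inner_add_left)
qed

lemma focal_sum_ray_decreases:
  assumes "P \<noteq> F" "P \<noteq> G" "normal F G P \<bullet> u < 0"
  shows "\<exists>t>0. focal_sum F G (P + t *\<^sub>R u) < focal_sum F G P"
proof -
  have "(focal_sum F G has_derivative (\<lambda>h. h \<bullet> normal F G P)) (at P)"
    using normal_eq[OF assms(1,2)] by (simp add: gderiv_def)
  then have 1: "(focal_sum F G has_derivative (\<lambda>h. h \<bullet> normal F G P)) (at (P + 0 *\<^sub>R u))" by simp
  have 2: "((\<lambda>t. P + t *\<^sub>R u) has_derivative (\<lambda>t. t *\<^sub>R u)) (at 0)"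
    by (auto intro!: derivative_eq_intros)
  have "((\<lambda>t. focal_sum F G (P + t *\<^sub>R u)) has_real_derivative (normal F G P \<bullet> u)) (at 0)"
    using has_derivative_compose[OF 2 1]
    by (simp add: has_field_derivative_def inner_commute mult_commute_abs)
  from DERIV_neg_dec_right[OF this assms(3)] obtain e where "e > 0"
    "\<And>h. 0 < h \<Longrightarrow> h < e \<Longrightarrow> focal_sum F G (P + h *\<^sub>R u) < focal_sum F G P"
    by auto
  then show ?thesis by (intro exI[of _ "e / 2"]) auto
qed

lemma ellipse_meets_inward_ray:
  assumes "P \<noteq> F" "P \<noteq> G" "normal F G P \<bullet> u < 0" "P \<in> ellipse F G r" "norm u = 1"
  shows "\<exists>t>0. P + t *\<^sub>R u \<in> ellipse F G r"
proof -
  obtain t where t: "t > 0" "focal_sum F G (P + t *\<^sub>R u) < r"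
    using focal_sum_ray_decreases[OF assms(1-3)] assms(4) by (auto simp: ellipse_def)
  \<comment> \<open>At this parameter the distance to \<open>F\<close> alone is at least
    \<open>r\<close>; the maximum keeps \<open>T\<close> beyond the interior point at
    \<open>t\<close>.\<close>
  define T where "T = max t (r + norm (P - F))"
  have "T - norm (P - F) \<le> norm ((P - F) + T *\<^sub>R u)"
    using norm_diff_ineq[of "T *\<^sub>R u" "P - F"] assms(5) t
    by (simp add: T_def add.commute)
  also have "\<dots> \<le> focal_sum F G (P + T *\<^sub>R u)"
    by (simp add: focal_sum_def dist_norm algebra_simps)
  finally have T: "r \<le> focal_sum F G (P + T *\<^sub>R u)" by (simp add: T_def)
  have "\<exists>x\<ge>t. x \<le> T \<and> focal_sum F G (P + x *\<^sub>R u) = r"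
    using t T by (intro IVT') (auto simp: T_def focal_sum_def intro!: continuous_intros)
  then show ?thesis using t by (auto simp: ellipse_def intro: less_le_trans)
qed

text \<open>If \<open>u\<close> points inward, the ray meets the ellipse again later; if
  \<open>u\<close> is tangent, the supporting line misses the table. If \<open>u\<close> points
  outward, the supporting inequality excludes later points of the ellipse, and the backward ray
  enters the table.\<close>

lemma hits_line_iff:
  fixes P u :: plane
  assumes "P \<noteq> F" "P \<noteq> G" "P \<in> ellipse F G r" "norm u = 1"
    and l: "l = (range (\<lambda>t. P + t *\<^sub>R u), u)"
  shows "hits F G r l P \<longleftrightarrow> normal F G P \<bullet> u > 0"
proof -
  have uu: "u \<bullet> u = 1" using assms(4) by (simp add: dot_square_norm)
  have PF: "focal_sum F G P = r" using assms(3) by (simp add: ellipse_def)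
  have sup: "r + t * (normal F G P \<bullet> u) \<le> focal_sum F G (P + t *\<^sub>R u)" for t
    using focal_sum_supporting[OF assms(1,2), of "P + t *\<^sub>R u"] by (simp add: PF)
  show ?thesis
  proof
    assume h: "hits F G r l P"
    then obtain t where "focal_sum F G (P + t *\<^sub>R u) < r"
      by (auto simp: hits_def l table_def)
    with sup[of t] have "normal F G P \<bullet> u \<noteq> 0" by auto
    moreover have "\<not> normal F G P \<bullet> u < 0"
    proof
      assume "normal F G P \<bullet> u < 0"
      from ellipse_meets_inward_ray[OF assms(1,2) this assms(3,4)]
      obtain t where t: "t > 0" "P + t *\<^sub>R u \<in> ellipse F G r" by auto
      then have "(P + t *\<^sub>R u) \<bullet> u \<le> P \<bullet> u" using h by (auto simp: hits_def l)
      then show False using t by (simp add: inner_add_left uu)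
    qed
    ultimately show "normal F G P \<bullet> u > 0" by linarith
  next
    assume n: "normal F G P \<bullet> u > 0"
    then have "normal F G P \<bullet> (- u) < 0" by simp
    then obtain t where t: "focal_sum F G (P + (- t) *\<^sub>R u) < r"
      using focal_sum_ray_decreases[OF assms(1,2)] unfolding PF by fastforce
    have le: "Y \<bullet> u \<le> P \<bullet> u" if Y: "Y \<in> range (\<lambda>t. P + t *\<^sub>R u)" "Y \<in> ellipse F G r" for Y
    proof -
      obtain t where t: "Y = P + t *\<^sub>R u" using Y(1) by auto
      have "t * (normal F G P \<bullet> u) \<le> 0" using sup[of t] Y(2) by (simp add: t ellipse_def)
      then have "t \<le> 0" using n by (simp add: mult_le_0_iff)
      then show ?thesis by (simp add: t inner_add_left uu)
    qed
    have "P \<in> range (\<lambda>t. P + t *\<^sub>R u)" by (rule range_eqI[of _ _ 0]) simp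
    moreover have "range (\<lambda>t. P + t *\<^sub>R u) \<inter> table F G r \<noteq> {}"
      using t unfolding table_def by blast
    ultimately show "hits F G r l P"
      using assms(3) le by (auto simp: hits_def l)
  qed
qed

section \<open>Oriented lines and the billiard map\<close>

text \<open>The case \<open>P = X\<close> is covered because \<open>sgn 0 = 0\<close>, which makes
  both sides the single point \<open>P\<close>.\<close>

lemma affine_hull_line:
  fixes P X :: plane
  shows "affine hull {P, X} = range (\<lambda>t. P + t *\<^sub>R sgn (X - P))"
proof (cases "P = X")
  case False
  have "P + t *\<^sub>R (X - P) = P + (t * norm (X - P)) *\<^sub>R sgn (X - P)"
    "P + t *\<^sub>R sgn (X - P) = P + (t / norm (X - P)) *\<^sub>R (X - P)" for t
    using False by (simp_all add: sgn_div_norm divide_inverse)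
  then have "range (\<lambda>t. P + t *\<^sub>R (X - P)) = range (\<lambda>t. P + t *\<^sub>R sgn (X - P))"
    by (metis (no_types, lifting) rangeI image_subsetI subset_antisym)
  then show ?thesis by (simp add: affine_hull_2_alt)
qed simp

lemma oline_from: "oline P X = (range (\<lambda>t. P + t *\<^sub>R sgn (X - P)), sgn (X - P))"
  by (simp add: oline_def affine_hull_line)

lemma oline_to: "oline X P = (range (\<lambda>t. P + t *\<^sub>R sgn (P - X)), sgn (P - X))"
proof -
  have "affine hull {X, P} = range (\<lambda>t. P + t *\<^sub>R sgn (X - P))"
    by (simp add: insert_commute[of X] affine_hull_line)
  also have "\<dots> = range (\<lambda>t. P + t *\<^sub>R sgn (P - X))"
  proof -
    have s: "sgn (X - P) = - sgn (P - X)" by (simp flip: sgn_minus)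
    have "P + t *\<^sub>R sgn (X - P) = P + (- t) *\<^sub>R sgn (P - X)"
      "P + t *\<^sub>R sgn (P - X) = P + (- t) *\<^sub>R sgn (X - P)" for t
      unfolding s by simp_all
    then show ?thesis
      by (metis (no_types, lifting) rangeI image_subsetI subset_antisym)
  qed
  finally show ?thesis by (simp add: oline_def)
qed

text \<open>The inner product with \<open>u\<close> is a coordinate on the line, so its maximizer is
  unique and the description in \<open>billiard_map\<close> is well defined.\<close>

lemma hits_unique:
  assumes l: "l = (range (\<lambda>t. P + t *\<^sub>R u), u)" and "norm u = 1"
    and "hits F G r l X" "hits F G r l Y"
  shows "X = Y"
proof -
  have uu: "u \<bullet> u = 1" using assms(2) by (simp add: dot_square_norm)
  obtain a b where X: "X = P + a *\<^sub>R u" and Y: "Y = P + b *\<^sub>R u"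
    using assms(3,4) by (auto simp: hits_def l)
  have "X \<bullet> u \<le> Y \<bullet> u" "Y \<bullet> u \<le> X \<bullet> u"
    using assms(3,4) unfolding hits_def l by auto
  then show ?thesis by (simp add: X Y inner_add_left uu)
qed

lemma billiard_map_hits:
  assumes l: "l = (range (\<lambda>t. P + t *\<^sub>R u), u)" and "norm u = 1" "hits F G r l P"
  shows "billiard_map F G r l = oline P (P + mirror (normal F G P) u)"
proof -
  have "(THE X. hits F G r l X) = P"
    using hits_unique[OF assms(1,2) _ assms(3)] assms(3) by (intro the_equality)
  then show ?thesis by (simp add: billiard_map_def l)
qed

section \<open>The reflection theorem\<close>

theorem theorem2:
  fixes F G A B P :: plane and s r :: real and J :: proj_point
  assumes "dist F G < s" and "dist F G < r" and "s \<noteq> r"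
    and "A \<in> ellipse F G s" and "P \<in> ellipse F G r"
    and "J \<in> proj_closure (tangent_line F G A)"
    and "J \<in> proj_closure (tangent_line F G P)"
    and "B \<in> ellipse F G s" and "B \<noteq> A"
    and "J \<in> proj_closure (tangent_line F G B)"
  shows "(hits F G r (oline P A) P \<or> hits F G r (oline A P) P) \<and>
    (hits F G r (oline P A) P \<longrightarrow>
       billiard_map F G r (oline P A) = oline P B) \<and>
    (hits F G r (oline A P) P \<longrightarrow>
       billiard_map F G r (oline A P) = (if s < r then oline P B else oline B P))"
proof -
  define d where "d = (1/2) *\<^sub>R (F - G)"
  define M where "M = midpoint F G"
  define k l where "k = (s/2)\<^sup>2" and "l = (r/2)\<^sup>2"
  define x y p where "x = A - M" and "y = B - M" and "p = P - M"
  define n where "n = conic_map d l p"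
  define z where "z = p + (k - l) *\<^sub>R n"
  note A = ellipse_conic[OF assms(1,4), folded d_def M_def k_def x_def]
  note B = ellipse_conic[OF assms(1,8), folded d_def M_def k_def y_def]
  note P = ellipse_conic[OF assms(2,5), folded d_def M_def l_def p_def, folded n_def]
  have sr: "0 < s" "0 < r" using assms(1,2) zero_le_dist[of F G] by linarith+
  have kl: "k < l \<longleftrightarrow> s < r" "l < k \<longleftrightarrow> r < s" "k \<noteq> l"
    using sr assms(3) by (auto simp: k_def l_def power2_eq_iff_nonneg
        intro: power_strict_mono dest: power_less_imp_less_base)
  have dd: "d \<bullet> d \<ge> 0" by simp
  have nz: "n = conic_map d k z"
    using conic_map_confocal_pole[of k d l p] dd A(1) P(1) unfolding z_def n_def by auto
  obtain c where c: "c > 0" and cn: "normal F G P = c *\<^sub>R n" using P(3) by auto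
  obtain ca where ca: "ca > 0" and can: "normal F G A = ca *\<^sub>R conic_map d k x" using A(3) by auto
  obtain cb where cb: "cb > 0" and cbn: "normal F G B = cb *\<^sub>R conic_map d k y" using B(3) by auto
  have n0: "n \<noteq> 0" using P(2) by auto
  have xy: "x \<noteq> y" using assms(9) by (simp add: x_def y_def)
  \<comment> \<open>The witness is a normal of the polar of the common point with respect to the
    ellipse through \<open>A\<close> and \<open>B\<close>. For a finite point this polar is the
    level 1 of the form against \<open>i\<close>; for an ideal point with direction \<open>t\<close>
    it is the level 0, a diameter. It contains \<open>x\<close>, \<open>y\<close> and the pole
    \<open>z\<close>.\<close>
  have "\<exists>w. w \<noteq> 0 \<and> w \<bullet> (y - x) = 0 \<and> w \<bullet> (z - x) = 0"
  proof (cases J)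
    case (Finite I)
    define i where "i = I - M"
    have IX: "I - A = i - x" "I - B = i - y" "I - P = i - p"
      by (simp_all add: i_def x_def y_def p_def)
    have "conic_map d k x \<bullet> (i - x) = 0" "conic_map d k y \<bullet> (i - y) = 0" "n \<bullet> (i - p) = 0"
      using assms(6,7,10) ca cb c
      by (simp_all add: proj_closure_tangent_line Finite can cbn cn IX)
    then have "conic_map d k x \<bullet> i = 1" "conic_map d k y \<bullet> i = 1" "conic_map d k z \<bullet> i = 1"
      using A(2) B(2) P(2) by (simp_all add: inner_diff_right flip: nz)
    then have "conic_map d k i \<bullet> x = 1" "conic_map d k i \<bullet> y = 1" "conic_map d k i \<bullet> z = 1"
      by (simp_all add: conic_map_inner_commute[of d k i])
    then show ?thesis by (intro exI[of _ "conic_map d k i"]) (auto simp: inner_diff_right)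
  next
    case (Ideal S)
    obtain t where t: "t \<noteq> 0" "n \<bullet> t = 0" using exists_orthogonal_plane by blast
    have "t \<in> S" using assms(7) t by (simp add: proj_closure_tangent_line Ideal cn)
    then have "conic_map d k x \<bullet> t = 0" "conic_map d k y \<bullet> t = 0"
      using assms(6,10) ca cb by (auto simp: proj_closure_tangent_line Ideal can cbn)
    then have "conic_map d k t \<bullet> x = 0" "conic_map d k t \<bullet> y = 0" "conic_map d k t \<bullet> z = 0"
      using t(2) by (simp_all add: conic_map_inner_commute[of d k t] nz)
    moreover have "conic_map d k t \<noteq> 0" using conic_map_pos[OF A(1) t(1)] by auto
    ultimately show ?thesis by (intro exI[of _ "conic_map d k t"]) (auto simp: inner_diff_right)
  qed
  then obtain t where "z - x = t *\<^sub>R (y - x)"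
    using orthogonal_complement_plane[of _ "y - x" "z - x"] xy by auto
  then have "p + (k - l) *\<^sub>R n = x + t *\<^sub>R (y - x)" by (simp add: z_def algebra_simps)
  from confocal_normal_decomposition[OF A(1) P(1) A(2) B(2) xy _ n_def this] P(2)
  obtain m where m: "m < 0"
    "((k - l) * m) *\<^sub>R n = (n \<bullet> (y - p)) *\<^sub>R (x - p) + (n \<bullet> (x - p)) *\<^sub>R (y - p)"
    unfolding n_def by blast
  have XP: "x - p = A - P" "y - p = B - P" by (simp_all add: x_def y_def p_def)
  note dec = m(2)[unfolded XP]
  define \<alpha> \<beta> where "\<alpha> = n \<bullet> (A - P)" and "\<beta> = n \<bullet> (B - P)"
  have c0: "(k - l) * m \<noteq> 0" using m kl by auto
  have pos: "\<alpha> * \<beta> * ((k - l) * m) > 0"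
    and mir: "mirror n (A - P) = - (\<alpha> / \<beta>) *\<^sub>R (B - P)"
    using mirror_of_combination[OF dec c0 n0] by (simp_all add: \<alpha>_def \<beta>_def)
  \<comment> \<open>Since \<open>m < 0\<close>, the sign of \<open>(k - l) * m\<close> tells which
    ellipse is larger. By \<open>pos\<close>, \<open>A\<close> and \<open>B\<close> lie on the same
    side of the tangent at \<open>P\<close> when \<open>s < r\<close>, and on opposite sides
    otherwise.\<close>
  have sg: "sgn (- (\<alpha> / \<beta>)) = (if s < r then - 1 else 1)"
  proof (cases "s < r")
    case True
    then have "(k - l) * m > 0" using kl m by (simp add: mult_neg_neg)
    then have "\<alpha> * \<beta> > 0" using pos by (rule zero_less_mult_pos2[rotated])
    then have "- (\<alpha> / \<beta>) < 0" by (simp add: zero_less_mult_iff zero_less_divide_iff)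
    then show ?thesis using True by (simp only: sgn_neg if_True)
  next
    case False
    then have "(k - l) * m < 0" using kl m assms(3) by (simp add: mult_pos_neg)
    then have "\<alpha> * \<beta> < 0" using pos by (meson less_imp_le mult_nonneg_nonpos not_le)
    then have "- (\<alpha> / \<beta>) > 0" by (simp add: mult_less_0_iff divide_less_0_iff)
    then show ?thesis using False by (simp only: sgn_pos if_False)
  qed
  define \<epsilon> :: real where "\<epsilon> = (if s < r then - 1 else 1)"
  have "mirror n (sgn (A - P)) = sgn (mirror n (A - P))"
    by (rule mirror_sgn[OF n0])
  also have "\<dots> = \<epsilon> *\<^sub>R sgn (B - P)"
    unfolding mir sgn_scaleR sg \<epsilon>_def ..
  finally have refl1: "mirror (normal F G P) (sgn (A - P)) = \<epsilon> *\<^sub>R sgn (B - P)"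
    using c by (simp add: cn mirror_normal_scaleR)
  have AP: "A \<noteq> P" using assms(3,4,5) by (auto simp: ellipse_def)
  have flip: "sgn (X - Y) = - sgn (Y - X)" for X Y :: plane by (simp flip: sgn_minus)
  have refl2: "mirror (normal F G P) (sgn (P - A)) = \<epsilon> *\<^sub>R sgn (P - B)"
    unfolding flip[of P A] mirror_uminus refl1 flip[of P B] by simp
  have PF: "P \<noteq> F" and PG: "P \<noteq> G"
    using assms(2,5) by (auto simp: ellipse_def focal_sum_def dist_commute)
  \<comment> \<open>The line through \<open>A\<close> and \<open>P\<close> is not tangent at
    \<open>P\<close>, so one of its orientations leaves the table there.\<close>
  have \<alpha>0: "\<alpha> \<noteq> 0" using pos by auto
  have nu: "normal F G P \<bullet> sgn (A - P) = c * \<alpha> / norm (A - P)"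
    by (simp add: cn \<alpha>_def sgn_div_norm divide_inverse)
  have u1: "norm (sgn (A - P)) = 1" "norm (sgn (P - A)) = 1" using AP by (simp_all add: norm_sgn)
  have h1: "hits F G r (oline P A) P \<longleftrightarrow> \<alpha> > 0"
    using hits_line_iff[OF PF PG assms(5) u1(1) oline_from] AP c
    by (simp add: nu zero_less_divide_iff zero_less_mult_iff)
  have h2: "hits F G r (oline A P) P \<longleftrightarrow> \<alpha> < 0"
    using hits_line_iff[OF PF PG assms(5) u1(2) oline_to] AP c
    unfolding flip[of P A] inner_minus_right nu
    by (simp add: divide_less_0_iff mult_less_0_iff)
  \<comment> \<open>A point of the smaller ellipse lies strictly on the inner side of the tangent at
    \<open>P\<close>, so the ray from \<open>P\<close> towards it enters the table. This excludes
    the orientation \<open>oline P A\<close> when \<open>s < r\<close>.\<close>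
  have inner: "\<alpha> < 0" if "s < r"
  proof -
    have "r + c * \<alpha> \<le> s"
      using focal_sum_supporting[OF PF PG, of A] assms(4,5)
      by (simp add: ellipse_def cn \<alpha>_def)
    then have "c * \<alpha> < 0" using that by linarith
    then show ?thesis using c by (simp add: mult_less_0_iff)
  qed
  have sgn_idem: "sgn (sgn v) = sgn v" for v :: plane
    by (simp add: sgn_div_norm[of "sgn v"] norm_sgn)
  have out: "oline P (P + sgn (X - P)) = oline P X"
    "oline P (P + sgn (P - X)) = oline X P" for X
    by (simp_all add: sgn_idem oline_from[of P "P + _"] oline_from[of P X] oline_to[of X P])
  have "billiard_map F G r (oline P A) = oline P B" if "hits F G r (oline P A) P"
  proof -
    have "\<not> s < r" using that h1 inner by force
    then show ?thesis
      using billiard_map_hits[OF oline_from u1(1) that] out[of B] by (simp add: refl1 \<epsilon>_def)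
  qed
  moreover have "billiard_map F G r (oline A P) = (if s < r then oline P B else oline B P)"
    if "hits F G r (oline A P) P"
    using billiard_map_hits[OF oline_to u1(2) that] out[of B]
    by (simp add: refl2 \<epsilon>_def flip[of P B])
  ultimately show ?thesis using h1 h2 \<alpha>0 by auto
qed

end
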